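(* Let $a<b$ be real numbers and assume that $g:[a,b]\to\mathbb{R}$ is differentiable (with finite derivative) almost everywhere on $[a,b]$. Then $g'$ is HK integrable on $[a,b]$ and $g(b)-g(a)=(HK)\int_a^b g'(s)\,ds$ if and only if $g$ has negligible conditional variation on the set of points of $[a,b]$ where $g$ is not differentiable.
   Context: Differentiable means having a finite derivative; at the endpoints of $[a,b]$ derivatives are one-sided. A tagged partition of $[a,b]$ is a finite set $P=\{(x_j,I_j):1\le j\le n\}$ with closed intervals $I_j=[a_j,b_j]$, $x_j\in I_j$, $\bigcup_j I_j=[a,b]$, and $(a_i,b_i)\cap(a_j,b_j)=\emptyset$ for $i\ne j$. A gauge on $[a,b]$ is a function $\delta:[a,b]\to(0,\infty)$. $P$ is subordinate to $\delta$ if $I_j\subseteq(x_j-\delta(x_j),x_j+\delta(x_j))$ for every $j$. A function $\phi:[a,b]\to\mathbb{R}$ is HK (Henstock–Kurzweil) integrable over $[a,b]$ with integral $(HK)\int_a^b\phi(x)\,dx=A$ if for every $\epsilon>0$ there is a gauge $\delta$ on $[a,b]$ such that every tagged partition $P$ of $[a,b]$ subordinate to $\delta$ satisfies $\left|\sum_{j}\phi(x_j)(b_j-a_j)-A\right|<\epsilon$. If $\phi$ is only defined almost everywhere, its HK integral means that of the function equal to $\phi$ where $\phi$ is defined and $0$ elsewhere. A function $\phi:[a,b]\to\mathbb{R}$ has negligible conditional variation on a set $E\subseteq[a,b]$ if for every $\epsilon>0$ there is a gauge $\delta$ on $[a,b]$ such that for every tagged partition $\{(x_j,[a_j,b_j]):1\le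 j\le n\}$ of $[a,b]$ subordinate to $\delta$, $\left|\sum_{x_j\in E}(\phi(b_j)-\phi(a_j))\right|<\epsilon$. *)

theory Defs
  imports "HOL-Analysis.Analysis"
begin

definition nondiff_points :: "(real \<Rightarrow> real) \<Rightarrow> real \<Rightarrow> real \<Rightarrow> real set" where
  "nondiff_points g a b = {x \<in> {a..b}. \<not> g differentiable (at x within {a..b})}"

(* Differentiating within {a..b} makes the derivatives at a and b one-sided, so that
   only the values of g on {a..b} matter. *)
definition deriv_or_zero :: "(real \<Rightarrow> real) \<Rightarrow> real \<Rightarrow> real \<Rightarrow> real \<Rightarrow> real" where
  "deriv_or_zero g a b x =
     (if g differentiable (at x within {a..b})
      then vector_derivative g (at x within {a..b}) else 0)"

(* For (x, K) in a tagged division of {a..b}, K is a nonempty compact interval with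
   end points Inf K and Sup K. It may be a single point; such a K contributes 0. *)
definition negligible_cond_variation ::
    "(real \<Rightarrow> real) \<Rightarrow> real \<Rightarrow> real \<Rightarrow> real set \<Rightarrow> bool" where
  "negligible_cond_variation \<phi> a b E \<longleftrightarrow>
     (\<forall>\<epsilon>>0. \<exists>\<delta> :: real \<Rightarrow> real. (\<forall>x\<in>{a..b}. \<delta> x > 0) \<and>
        (\<forall>P. P tagged_division_of {a..b} \<and> (\<lambda>x. {x - \<delta> x <..< x + \<delta> x}) fine P \<longrightarrow>
           \<bar>\<Sum>(x, K)\<in>{(x, K) \<in> P. x \<in> E}. \<phi> (Sup K) - \<phi> (Inf K)\<bar> < \<epsilon>))"

end

theory Submission
  imports Defs
begin

text \<open>
  Let \<open>E\<close> be the set of points where \<open>g\<close> is not differentiable and let \<open>f\<close> be the derivative of \<open>g\<close>,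
  extended by \<open>0\<close> to \<open>E\<close>. For a tagged division \<open>P\<close> of \<open>{a..b}\<close>, the increments of \<open>g\<close> over the
  intervals of \<open>P\<close> telescope to \<open>g b - g a\<close>, and the intervals tagged in \<open>E\<close> contribute nothing to
  the Riemann sum of \<open>f\<close>. Hence the Riemann sum minus \<open>g b - g a\<close> is the difference of two sums:
  the sum of \<open>f x * (v - u) - (g v - g u)\<close> over the intervals \<open>{u..v}\<close> of \<open>P\<close> with tag
  \<open>x \<notin> E\<close>, and the sum of the increments \<open>g v - g u\<close> over those with tag in \<open>E\<close>.

  The first of these can be made small by the choice of the gauge alone: at a point of
  differentiability the straddle estimate (\<open>straddle_estimate\<close>) bounds each summand by a small
  multiple of \<open>v - u\<close>, and the lengths add up to at most \<open>b - a\<close>. So the Riemann sum differs from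
  \<open>g b - g a\<close> by the negative of the conditional variation on \<open>E\<close>, up to an arbitrarily small error
  (\<open>riemann_sum_near_increment_minus_variation\<close>), and one of the two is controlled by a gauge
  exactly when the other is. Two gauges are combined by taking the pointwise minimum of the radii.
\<close>

lemma fine_mono:
  assumes "\<gamma> fine P" and "\<And>x. \<gamma> x \<subseteq> \<gamma>' x"
  shows "\<gamma>' fine P"
  using assms unfolding fine_def by blast

lemma fine_radius_mono:
  fixes \<delta> \<eta> :: "real \<Rightarrow> real"
  assumes "(\<lambda>x. {x - \<delta> x <..< x + \<delta> x}) fine P" and "\<And>x. \<delta> x \<le> \<eta> x"
  shows "(\<lambda>x. {x - \<eta> x <..< x + \<eta> x}) fine P"
proof (rule fine_mono[OF assms(1)])
  show "{x - \<delta> x <..< x + \<delta> x} \<subseteq> {x - \<eta> x <..< x + \<eta> x}" for x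
    using assms(2)[of x] by auto
qed

text \<open>Inside an open neighbourhood of \<open>x\<close> lies a symmetric interval around \<open>x\<close>, so gauges given by
  open sets and gauges given by radii define the same integral. Only radii at points of
  \<open>{a..b}\<close> matter, because tags lie there.\<close>
lemma has_integral_real_radius:
  fixes f :: "real \<Rightarrow> real"
  shows "(f has_integral I) {a..b} \<longleftrightarrow>
    (\<forall>\<epsilon>>0. \<exists>\<delta>. (\<forall>x\<in>{a..b}. \<delta> x > 0) \<and>
       (\<forall>P. P tagged_division_of {a..b} \<and> (\<lambda>x. {x - \<delta> x <..< x + \<delta> x}) fine P \<longrightarrow>
          \<bar>(\<Sum>(x, K)\<in>P. measure lborel K * f x) - I\<bar> < \<epsilon>))"
    (is "_ \<longleftrightarrow> ?R")
proof
  assume "(f has_integral I) {a..b}"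
  then have f: "(f has_integral I) (cbox a b)"
    by simp
  show ?R
  proof (intro allI impI)
    fix \<epsilon> :: real assume "\<epsilon> > 0"
    obtain \<gamma> where "gauge \<gamma>"
      and \<gamma>: "\<And>P. P tagged_division_of cbox a b \<Longrightarrow> \<gamma> fine P \<Longrightarrow>
                 norm ((\<Sum>(x, K)\<in>P. measure lborel K *\<^sub>R f x) - I) < \<epsilon>"
      by (rule has_integralD[OF f \<open>\<epsilon> > 0\<close>]) blast
    have "\<exists>d>0. ball x d \<subseteq> \<gamma> x" for x
      using \<open>gauge \<gamma>\<close> by (meson gauge_def openE)
    then obtain \<delta> where pos: "\<And>x. \<delta> x > 0" and "\<And>x. ball x (\<delta> x) \<subseteq> \<gamma> x"
      by metis
    then have sub: "\<And>x. {x - \<delta> x <..< x + \<delta> x} \<subseteq> \<gamma> x"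
      by (simp add: ball_eq_greaterThanLessThan)
    have "\<bar>(\<Sum>(x, K)\<in>P. measure lborel K * f x) - I\<bar> < \<epsilon>"
      if "P tagged_division_of {a..b}" "(\<lambda>x. {x - \<delta> x <..< x + \<delta> x}) fine P" for P
      using \<gamma>[of P] that(1) fine_mono[OF that(2) sub] by simp
    with pos show "\<exists>\<delta>. (\<forall>x\<in>{a..b}. \<delta> x > 0) \<and>
       (\<forall>P. P tagged_division_of {a..b} \<and> (\<lambda>x. {x - \<delta> x <..< x + \<delta> x}) fine P \<longrightarrow>
          \<bar>(\<Sum>(x, K)\<in>P. measure lborel K * f x) - I\<bar> < \<epsilon>)"
      by (intro exI[of _ \<delta>]) simp
  qed
next
  assume ?R
  show "(f has_integral I) {a..b}"
    unfolding has_integral_real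
  proof (intro allI impI)
    fix \<epsilon> :: real assume "\<epsilon> > 0"
    from \<open>?R\<close>[rule_format, OF this] obtain \<delta> where pos: "\<forall>x\<in>{a..b}. \<delta> x > 0"
      and \<delta>: "\<forall>P. P tagged_division_of {a..b} \<and> (\<lambda>x. {x - \<delta> x <..< x + \<delta> x}) fine P \<longrightarrow>
                 \<bar>(\<Sum>(x, K)\<in>P. measure lborel K * f x) - I\<bar> < \<epsilon>"
      by (elim exE conjE)
    \<comment> \<open>A gauge must be defined on the whole line; outside \<open>{a..b}\<close> its values are arbitrary.\<close>
    define \<gamma> where "\<gamma> x = (if x \<in> {a..b} then {x - \<delta> x <..< x + \<delta> x} else UNIV)" for x
    have "gauge \<gamma>"
      using pos by (auto simp: gauge_def \<gamma>_def)
    moreover have "(\<lambda>x. {x - \<delta> x <..< x + \<delta> x}) fine P"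
      if "P tagged_division_of {a..b}" "\<gamma> fine P" for P
      unfolding fine_def
    proof (intro ballI, clarify)
      fix x K y assume "(x, K) \<in> P" "y \<in> K"
      moreover from this that have "x \<in> {a..b}" "K \<subseteq> \<gamma> x"
        by (blast dest: tag_in_interval, auto simp: fine_def)
      ultimately show "y \<in> {x - \<delta> x <..< x + \<delta> x}"
        by (auto simp: \<gamma>_def)
    qed
    ultimately show "\<exists>\<gamma>. gauge \<gamma> \<and> (\<forall>P. P tagged_division_of {a..b} \<and> \<gamma> fine P \<longrightarrow>
        norm ((\<Sum>(x, K)\<in>P. measure lborel K *\<^sub>R f x) - I) < \<epsilon>)"
      using \<delta> by (intro exI[of _ \<gamma>]) simp
  qed
qed

text \<open>Since \<open>x\<close> lies between \<open>u\<close> and \<open>v\<close>, the errors of the linear approximation at \<open>u\<close> and at \<open>v\<close>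
  are at most \<open>e * (x - u)\<close> and \<open>e * (v - x)\<close>, which add up to \<open>e * (v - u)\<close>.\<close>
lemma straddle_estimate:
  fixes g :: "real \<Rightarrow> real"
  assumes "(g has_vector_derivative D) (at x within S)" and "e > 0"
  obtains d where "d > 0"
    and "\<And>u v. \<lbrakk>u \<in> S; v \<in> S; u \<le> x; x \<le> v; x - d < u; v < x + d\<rbrakk>
           \<Longrightarrow> \<bar>(v - u) * D - (g v - g u)\<bar> \<le> e * (v - u)"
proof -
  from assms obtain d where "d > 0"
    and d: "\<And>y. y \<in> S \<Longrightarrow> \<bar>y - x\<bar> < d \<Longrightarrow> \<bar>g y - g x - (y - x) * D\<bar> \<le> e * \<bar>y - x\<bar>"
    unfolding has_vector_derivative_def has_derivative_within_alt
    by (metis real_norm_def real_scaleR_def)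
  have "\<bar>(v - u) * D - (g v - g u)\<bar> \<le> e * (v - u)"
    if "u \<in> S" "v \<in> S" "u \<le> x" "x \<le> v" "x - d < u" "v < x + d" for u v
  proof -
    have "\<bar>g u - g x - (u - x) * D\<bar> \<le> e * (x - u)" "\<bar>g v - g x - (v - x) * D\<bar> \<le> e * (v - x)"
      using d[of u] d[of v] that by simp_all
    moreover have "(v - u) * D - (g v - g u)
        = (g u - g x - (u - x) * D) - (g v - g x - (v - x) * D)"
      by (simp add: algebra_simps)
    moreover have "e * (v - u) = e * (x - u) + e * (v - x)"
      by (simp add: algebra_simps)
    ultimately show ?thesis
      by linarith
  qed
  with \<open>d > 0\<close> show thesis
    by (rule that)
qed

lemma deriv_or_zero_nondiff_points:
  "x \<in> nondiff_points g a b \<Longrightarrow> deriv_or_zero g a b x = 0"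
  by (simp add: nondiff_points_def deriv_or_zero_def)

lemma has_vector_derivative_deriv_or_zero:
  assumes "x \<in> {a..b}" "x \<notin> nondiff_points g a b"
  shows "(g has_vector_derivative deriv_or_zero g a b x) (at x within {a..b})"
  using assms by (simp add: nondiff_points_def deriv_or_zero_def vector_derivative_works)

text \<open>Both directions of the equivalence compare the two error terms through this estimate. The
  summands outside the exceptional set have total size at most a fixed small multiple of the length
  of \<open>{a..b}\<close>; for those inside it the increment taken from
  \<open>g b - g a\<close> cancels against the variation, since the derivative counts as \<open>0\<close> there.\<close>
lemma riemann_sum_near_increment_minus_variation:
  fixes g :: "real \<Rightarrow> real"
  assumes "a < b" and "\<epsilon> > 0"
  defines "E \<equiv> nondiff_points g a b"
  obtains \<delta> :: "real \<Rightarrow> real" where "\<And>x. x \<in> {a..b} \<Longrightarrow> \<delta> x > 0"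
    and "\<And>P. \<lbrakk>P tagged_division_of {a..b}; (\<lambda>x. {x - \<delta> x <..< x + \<delta> x}) fine P\<rbrakk>
      \<Longrightarrow> \<bar>(\<Sum>(x, K)\<in>P. measure lborel K * deriv_or_zero g a b x) - (g b - g a)
           + (\<Sum>(x, K)\<in>{(x, K) \<in> P. x \<in> E}. g (Sup K) - g (Inf K))\<bar> \<le> \<epsilon>"
proof -
  define e where "e = \<epsilon> / (b - a)"
  have "e > 0"
    using assms by (simp add: e_def)
  let ?f = "deriv_or_zero g a b"
  have "\<exists>d>0. x \<in> {a..b} - E \<longrightarrow>
      (\<forall>u v. u \<in> {a..b} \<and> v \<in> {a..b} \<and> u \<le> x \<and> x \<le> v \<and> x - d < u \<and> v < x + d \<longrightarrow>
        \<bar>(v - u) * ?f x - (g v - g u)\<bar> \<le> e * (v - u))" for x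
  proof (cases "x \<in> {a..b} - E")
    case True
    then have "(g has_vector_derivative ?f x) (at x within {a..b})"
      unfolding E_def by (blast intro: has_vector_derivative_deriv_or_zero)
    from straddle_estimate[OF this \<open>e > 0\<close>] show ?thesis
      by metis
  qed (auto intro: exI[of _ 1])
  then obtain \<delta> where pos: "\<And>x. \<delta> x > 0"
    and \<delta>: "\<And>x u v. \<lbrakk>x \<in> {a..b} - E; u \<in> {a..b}; v \<in> {a..b}; u \<le> x; x \<le> v;
               x - \<delta> x < u; v < x + \<delta> x\<rbrakk> \<Longrightarrow> \<bar>(v - u) * ?f x - (g v - g u)\<bar> \<le> e * (v - u)"
    by metis
  have "\<bar>(\<Sum>(x, K)\<in>P. measure lborel K * ?f x) - (g b - g a)
         + (\<Sum>(x, K)\<in>{(x, K) \<in> P. x \<in> E}. g (Sup K) - g (Inf K))\<bar> \<le> \<epsilon>"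
    if P: "P tagged_division_of {a..b}" and fine: "(\<lambda>x. {x - \<delta> x <..< x + \<delta> x}) fine P" for P
  proof -
    have "finite P"
      using P by (rule tagged_division_of_finite)
    have telescope: "(\<Sum>(x, K)\<in>P. g (Sup K) - g (Inf K)) = g b - g a"
      using additive_tagged_division_1[OF _ P] \<open>a < b\<close> by simp
    have variation: "(\<Sum>(x, K)\<in>{(x, K) \<in> P. x \<in> E}. g (Sup K) - g (Inf K))
        = (\<Sum>(x, K)\<in>P. if x \<in> E then g (Sup K) - g (Inf K) else 0)"
      using \<open>finite P\<close> by (intro sum.mono_neutral_cong_left) (auto split: if_splits)
    have "(\<Sum>(x, K)\<in>P. measure lborel K * ?f x) - (g b - g a)
         + (\<Sum>(x, K)\<in>{(x, K) \<in> P. x \<in> E}. g (Sup K) - g (Inf K))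
        = (\<Sum>(x, K)\<in>P. measure lborel K * ?f x - (g (Sup K) - g (Inf K))
             + (if x \<in> E then g (Sup K) - g (Inf K) else 0))"
      unfolding variation telescope[symmetric] sum_subtractf[symmetric] sum.distrib[symmetric]
      by (intro sum.cong) auto
    also have "\<bar>\<dots>\<bar> \<le> (\<Sum>(x, K)\<in>P. e * measure lborel K)"
    proof (rule sum_abs[THEN order_trans], rule sum_mono, clarify)
      fix x K assume xK: "(x, K) \<in> P"
      then obtain u v where K: "K = {u..v}"
        using tagged_division_ofD(4)[OF P xK] by auto
      have xuv: "u \<le> x" "x \<le> v" "x \<in> {a..b}" and sub: "{u..v} \<subseteq> {a..b}"
        using tagged_division_ofD(2,3)[OF P xK] K by auto
      have uv: "u \<in> {a..b}" "v \<in> {a..b}" "u \<le> v"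
        using xuv sub by auto
      have "{u..v} \<subseteq> {x - \<delta> x <..< x + \<delta> x}"
        using fineD[OF fine xK] K by simp
      then have near: "x - \<delta> x < u" "v < x + \<delta> x"
        using \<open>u \<le> v\<close> by auto
      show "\<bar>measure lborel K * ?f x - (g (Sup K) - g (Inf K))
          + (if x \<in> E then g (Sup K) - g (Inf K) else 0)\<bar> \<le> e * measure lborel K"
      proof (cases "x \<in> E")
        case True
        then show ?thesis
          using \<open>e > 0\<close> by (simp add: E_def deriv_or_zero_nondiff_points)
      next
        case False
        then show ?thesis
          using \<delta>[of x u v] xuv uv near by (simp add: K)
      qed
    qed
    also have "\<dots> = e * (\<Sum>(x, K)\<in>P. measure lborel K)"
      by (simp add: sum_distrib_left case_prod_unfold)
    also have "\<dots> = e * (b - a)"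
      using additive_content_tagged_division[of P a b] P \<open>a < b\<close> by simp
    also have "\<dots> = \<epsilon>"
      using \<open>a < b\<close> by (simp add: e_def)
    finally show ?thesis .
  qed
  with pos show thesis
    using that by blast
qed

text \<open>If two functionals of tagged divisions add up to something that gauges make arbitrarily small,
  then gauges make one of them small if and only if they make the other small.\<close>
lemma small_on_fine_divisions_transfer:
  fixes R V :: "(real \<times> real set) set \<Rightarrow> real"
  assumes sum: "\<And>\<epsilon>. \<epsilon> > 0 \<Longrightarrow> \<exists>\<delta>. (\<forall>x\<in>{a..b}. \<delta> x > 0) \<and>
       (\<forall>P. P tagged_division_of {a..b} \<and> (\<lambda>x. {x - \<delta> x <..< x + \<delta> x}) fine P \<longrightarrow>
          \<bar>R P + V P\<bar> \<le> \<epsilon>)"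
    and R: "\<forall>\<epsilon>>0. \<exists>\<delta>. (\<forall>x\<in>{a..b}. \<delta> x > 0) \<and>
       (\<forall>P. P tagged_division_of {a..b} \<and> (\<lambda>x. {x - \<delta> x <..< x + \<delta> x}) fine P \<longrightarrow>
          \<bar>R P\<bar> < \<epsilon>)"
  shows "\<forall>\<epsilon>>0. \<exists>\<delta>. (\<forall>x\<in>{a..b}. \<delta> x > 0) \<and>
       (\<forall>P. P tagged_division_of {a..b} \<and> (\<lambda>x. {x - \<delta> x <..< x + \<delta> x}) fine P \<longrightarrow>
          \<bar>V P\<bar> < \<epsilon>)"
proof (intro allI impI)
  fix \<epsilon> :: real assume "\<epsilon> > 0"
  then have "\<epsilon> / 2 > 0"
    by simp
  obtain \<delta> where \<delta>: "\<forall>x\<in>{a..b}. \<delta> x > 0"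
    "\<forall>P. P tagged_division_of {a..b} \<and> (\<lambda>x. {x - \<delta> x <..< x + \<delta> x}) fine P \<longrightarrow>
       \<bar>R P + V P\<bar> \<le> \<epsilon> / 2"
    using sum[OF \<open>\<epsilon> / 2 > 0\<close>] by blast
  obtain \<eta> where \<eta>: "\<forall>x\<in>{a..b}. \<eta> x > 0"
    "\<forall>P. P tagged_division_of {a..b} \<and> (\<lambda>x. {x - \<eta> x <..< x + \<eta> x}) fine P \<longrightarrow>
       \<bar>R P\<bar> < \<epsilon> / 2"
    using R \<open>\<epsilon> / 2 > 0\<close> by blast
  have "\<bar>V P\<bar> < \<epsilon>"
    if "P tagged_division_of {a..b}"
      "(\<lambda>x. {x - min (\<delta> x) (\<eta> x) <..< x + min (\<delta> x) (\<eta> x)}) fine P" for P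
  proof -
    have "\<bar>R P + V P\<bar> \<le> \<epsilon> / 2" "\<bar>R P\<bar> < \<epsilon> / 2"
      using that(1) \<delta>(2) \<eta>(2) fine_radius_mono[OF that(2), of \<delta>]
        fine_radius_mono[OF that(2), of \<eta>] by simp_all
    then show ?thesis
      by linarith
  qed
  with \<delta>(1) \<eta>(1) show "\<exists>\<delta>. (\<forall>x\<in>{a..b}. \<delta> x > 0) \<and>
       (\<forall>P. P tagged_division_of {a..b} \<and> (\<lambda>x. {x - \<delta> x <..< x + \<delta> x}) fine P \<longrightarrow>
          \<bar>V P\<bar> < \<epsilon>)"
    by (intro exI[of _ "\<lambda>x. min (\<delta> x) (\<eta> x)"]) simp
qed

theorem corollary1:
  fixes a b :: real and g :: "real \<Rightarrow> real"
  assumes "a < b"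
    and "AE x in lebesgue_on {a..b}. g differentiable (at x within {a..b})"
  shows "(deriv_or_zero g a b integrable_on {a..b} \<and>
            g b - g a = integral {a..b} (deriv_or_zero g a b))
         \<longleftrightarrow> negligible_cond_variation g a b (nondiff_points g a b)"
proof -
  define R where "R P = (\<Sum>(x, K)\<in>P. measure lborel K * deriv_or_zero g a b x) - (g b - g a)"
    for P :: "(real \<times> real set) set"
  define V where "V P = (\<Sum>(x, K)\<in>{(x, K) \<in> P. x \<in> nondiff_points g a b}. g (Sup K) - g (Inf K))"
    for P :: "(real \<times> real set) set"
  have sum: "\<exists>\<delta>. (\<forall>x\<in>{a..b}. \<delta> x > 0) \<and>
       (\<forall>P. P tagged_division_of {a..b} \<and> (\<lambda>x. {x - \<delta> x <..< x + \<delta> x}) fine P \<longrightarrow>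
          \<bar>R P + V P\<bar> \<le> \<epsilon>)" if "\<epsilon> > 0" for \<epsilon>
    unfolding R_def V_def
    by (rule riemann_sum_near_increment_minus_variation[OF \<open>a < b\<close> that, of g])
      (intro exI conjI ballI allI impI, assumption, elim conjE)
  note sum' = sum[unfolded add.commute[of "R _"]]
  have "(deriv_or_zero g a b integrable_on {a..b} \<and>
            g b - g a = integral {a..b} (deriv_or_zero g a b))
        \<longleftrightarrow> (deriv_or_zero g a b has_integral (g b - g a)) {a..b}"
    by (metis has_integral_integrable_integral)
  also have "\<dots> \<longleftrightarrow> negligible_cond_variation g a b (nondiff_points g a b)"
    unfolding has_integral_real_radius negligible_cond_variation_def
      R_def[symmetric] V_def[symmetric]
    by (rule iffI) (rule small_on_fine_divisions_transfer, erule sum sum', assumption)+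
  finally show ?thesis .
qed

end
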